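(* For every $n\geq 1$ and every $P\in\mathcal{D}_n^{h,\geq}$, $$\#DUD(P)=\#F(\phi(P))-\#UF^+D(\phi(P))-\delta_{F^n}(\phi(P)),$$ where $\delta_{F^n}(Q)=1$ if $Q=F^n$ and $\delta_{F^n}(Q)=0$ otherwise.
   Context: A Motzkin path of length $n$ is a word in the steps $U=(1,1)$, $D=(1,-1)$, $F=(1,0)$ forming a lattice path from $(0,0)$ to $(n,0)$ never going below the $x$-axis; $\mathcal{M}_n$ is the set of them. A Dyck path of semilength $n$ is a Motzkin path of length $2n$ without $F$ steps. Every nonempty Dyck path has a unique first return decomposition $P=U\alpha D\beta$ with $\alpha,\beta$ Dyck paths; $h$ denotes maximal height. $\mathcal{D}^{h,\geq}$ is defined recursively: it contains the empty path $\epsilon$, and $P=U\alpha D\beta$ belongs to it iff $\alpha,\beta\in\mathcal{D}^{h,\geq}$ and $h(U\alpha D)\geq h(\beta)$; $\mathcal{D}_n^{h,\geq}$ is the subset of semilength $n$. The bijection $\phi:\mathcal{D}_n^{h,\geq}\to\mathcal{M}_n$ is defined by $\phi(\epsilon)=\epsilon$, $\phi(\alpha UD)=\phi(\alpha)F$, $\phi(\alpha UU\beta D\gamma D)=\phi(\alpha)\phi(\gamma)U\phi(\beta)D$. For a word $X$, $\#X(P)$ is the number of occurrences of $X$ as consecutive steps in $P$. For words $Y,Z$ and a step $S$, $\#YS^+Z(P)=\sum_{k\geq 1}\#YS^kZ(P)$, where $S^k$ is $k$ consecutive copies of $S$. *)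

theory Defs
  imports Main
begin

datatype step = U | D | F

fun rise :: "step \<Rightarrow> int" where
  "rise U = 1"
| "rise D = -1"
| "rise F = 0"

definition level :: "step list \<Rightarrow> int" where
  "level P = sum_list (map rise P)"

definition is_motzkin :: "step list \<Rightarrow> bool" where
  "is_motzkin P \<longleftrightarrow> level P = 0 \<and> (\<forall>k\<le>length P. 0 \<le> level (take k P))"

definition motzkin_paths :: "nat \<Rightarrow> step list set" where
  "motzkin_paths n = {P. is_motzkin P \<and> length P = n}"

definition is_dyck :: "step list \<Rightarrow> bool" where
  "is_dyck P \<longleftrightarrow> is_motzkin P \<and> F \<notin> set P"

definition dyck_paths :: "nat \<Rightarrow> step list set" where
  "dyck_paths n = {P \<in> motzkin_paths (2 * n). F \<notin> set P}"

definition height :: "step list \<Rightarrow> int" where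
  "height P = Max ((\<lambda>k. level (take k P)) ` {..length P})"

text \<open>Since the first return decomposition is unique, the introduction rule is an equivalence for
  Dyck paths \<open>\<alpha>\<close>, \<open>\<beta>\<close> (\<open>Dh_iff\<close> below).\<close>

inductive_set Dh :: "step list set" where
  Nil: "[] \<in> Dh"
| first_return: "\<lbrakk>\<alpha> \<in> Dh; \<beta> \<in> Dh; height ([U] @ \<alpha> @ [D]) \<ge> height \<beta>\<rbrakk> \<Longrightarrow> [U] @ \<alpha> @ [D] @ \<beta> \<in> Dh"

definition Dh_paths :: "nat \<Rightarrow> step list set" where
  "Dh_paths n = Dh \<inter> dyck_paths n"

definition occ :: "step list \<Rightarrow> step list \<Rightarrow> nat" where
  "occ X P = card {i. i + length X \<le> length P \<and> take (length X) (drop i P) = X}"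

text \<open>Summing over \<open>k \<le> length P\<close> loses nothing: longer words do not occur in \<open>P\<close>
  (\<open>occ_eq_0\<close> below).\<close>

definition occ_plus :: "step list \<Rightarrow> step \<Rightarrow> step list \<Rightarrow> step list \<Rightarrow> nat" where
  "occ_plus Y S Z P = (\<Sum>k = 1..length P. occ (Y @ replicate k S @ Z) P)"

definition delta_F :: "nat \<Rightarrow> step list \<Rightarrow> nat" where
  "delta_F n Q = (if Q = replicate n F then 1 else 0)"

lemma occ_eq_0: "length P < length X \<Longrightarrow> occ X P = 0"
  by (simp add: occ_def)

lemma level_simps [simp]:
  "level [] = 0" "level (s # P) = rise s + level P" "level (P @ Q) = level P + level Q"
  by (simp_all add: level_def)

lemma nonneg_prefixes_iff:
  "(\<forall>k\<le>length P. 0 \<le> level (take k P)) \<longleftrightarrow> (\<forall>A B. P = A @ B \<longrightarrow> 0 \<le> level A)"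
proof
  assume *: "\<forall>k\<le>length P. 0 \<le> level (take k P)"
  show "\<forall>A B. P = A @ B \<longrightarrow> 0 \<le> level A"
  proof (intro allI impI)
    fix A B assume "P = A @ B"
    with *[rule_format, of "length A"] show "0 \<le> level A" by simp
  qed
next
  assume "\<forall>A B. P = A @ B \<longrightarrow> 0 \<le> level A"
  then show "\<forall>k\<le>length P. 0 \<le> level (take k P)" by (metis append_take_drop_id)
qed

lemma is_dyck_iff:
  "is_dyck P \<longleftrightarrow> level P = 0 \<and> (\<forall>A B. P = A @ B \<longrightarrow> 0 \<le> level A) \<and> F \<notin> set P"
  by (simp only: is_dyck_def is_motzkin_def nonneg_prefixes_iff conj_assoc)

lemma is_dyckI:
  "\<lbrakk>level P = 0; \<And>A B. P = A @ B \<Longrightarrow> 0 \<le> level A; F \<notin> set P\<rbrakk> \<Longrightarrow> is_dyck P"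
  by (simp add: is_dyck_iff)

lemma is_dyck_level: "is_dyck P \<Longrightarrow> level P = 0"
  and is_dyck_prefix: "is_dyck (A @ B) \<Longrightarrow> 0 \<le> level A"
  and is_dyck_no_F: "is_dyck P \<Longrightarrow> F \<notin> set P"
  by (auto simp: is_dyck_iff)

lemma is_dyck_Nil [simp]: "is_dyck []"
  by (rule is_dyckI) auto

lemma parity_level: "F \<notin> set P \<Longrightarrow> even (level P) = even (length P)"
proof (induction P)
  case (Cons s P) then show ?case by (cases s) auto
qed simp

lemma is_dyck_iff_dyck_paths: "is_dyck P \<longleftrightarrow> (\<exists>n. P \<in> dyck_paths n)"
proof
  assume P: "is_dyck P"
  then have "even (length P)"
    using parity_level[of P] by (simp add: is_dyck_level is_dyck_no_F)
  with P show "\<exists>n. P \<in> dyck_paths n"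
    by (auto simp: is_dyck_def dyck_paths_def motzkin_paths_def elim: evenE)
qed (auto simp: is_dyck_def dyck_paths_def motzkin_paths_def)

lemma is_motzkin_iff:
  "is_motzkin P \<longleftrightarrow> level P = 0 \<and> (\<forall>A B. P = A @ B \<longrightarrow> 0 \<le> level A)"
  by (simp only: is_motzkin_def nonneg_prefixes_iff)

lemma is_motzkin_append:
  assumes a: "is_motzkin a" and b: "is_motzkin b"
  shows "is_motzkin (a @ b)"
  unfolding is_motzkin_iff
proof (intro conjI allI impI)
  fix A B assume "a @ b = A @ B"
  then consider c where "a = A @ c" | c where "A = a @ c" "b = c @ B"
    by (auto simp: append_eq_append_conv2)
  then show "0 \<le> level A"
    by cases (use a b in \<open>auto simp: is_motzkin_iff\<close>)
qed (use a b in \<open>auto simp: is_motzkin_iff\<close>)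

lemma is_motzkin_lift:
  assumes a: "is_motzkin a"
  shows "is_motzkin ([U] @ a @ [D])"
  unfolding is_motzkin_iff
proof (intro conjI allI impI)
  fix A B assume "[U] @ a @ [D] = A @ B"
  then consider "A = []" | A' where "A = U # A'" "a @ [D] = A' @ B"
    by (cases A) auto
  then show "0 \<le> level A"
  proof cases
    case 2
    show ?thesis
    proof (cases B rule: rev_cases)
      case Nil
      with 2 a show ?thesis by (auto simp: is_motzkin_iff)
    next
      case (snoc B' s)
      with 2 a show ?thesis by (auto simp: is_motzkin_iff)
    qed
  qed simp
qed (use a in \<open>auto simp: is_motzkin_iff\<close>)

lemma is_dyck_append: "\<lbrakk>is_dyck a; is_dyck b\<rbrakk> \<Longrightarrow> is_dyck (a @ b)"
  by (simp add: is_dyck_def is_motzkin_append)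

lemma is_dyck_lift: "is_dyck a \<Longrightarrow> is_dyck ([U] @ a @ [D])"
  using is_motzkin_lift[of a] by (simp add: is_dyck_def)

lemma is_dyck_suffix:
  assumes ab: "is_dyck (a @ b)" and a: "level a = 0"
  shows "is_dyck b"
proof (rule is_dyckI)
  show "level b = 0" using is_dyck_level[OF ab] a by simp
  show "F \<notin> set b" using is_dyck_no_F[OF ab] by simp
  fix A B assume "b = A @ B"
  with ab a show "0 \<le> level A" using is_dyck_prefix[of "a @ A" B] by simp
qed

lemma dyck_or_first_descent:
  "F \<notin> set w \<Longrightarrow> (\<forall>A B. w = A @ B \<longrightarrow> 0 \<le> level A) \<or> (\<exists>a b. w = a @ [D] @ b \<and> is_dyck a)"
proof (induction w rule: rev_induct)
  case (snoc s w)
  show ?case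
  proof (cases "\<exists>a b. w = a @ [D] @ b \<and> is_dyck a")
    case True
    then obtain a b where "w = a @ [D] @ b" "is_dyck a" by blast
    then have "w @ [s] = a @ [D] @ (b @ [s])" by simp
    with \<open>is_dyck a\<close> show ?thesis by blast
  next
    case False
    with snoc have nn: "\<forall>A B. w = A @ B \<longrightarrow> 0 \<le> level A" by auto
    show ?thesis
    proof (cases "0 \<le> level (w @ [s])")
      case True
      have "0 \<le> level A" if "w @ [s] = A @ B" for A B
        using that nn True by (cases B rule: rev_cases) auto
      then show ?thesis by blast
    next
      case False
      moreover have "0 \<le> level w" using nn by (metis append_Nil2)
      ultimately have "s = D" "level w = 0" by (cases s; simp)+
      with nn snoc.prems have "is_dyck w" by (auto simp: is_dyck_iff)
      with \<open>s = D\<close> show ?thesis by auto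
    qed
  qed
qed simp

lemma first_return_ex:
  assumes P: "is_dyck P" and "P \<noteq> []"
  obtains \<alpha> \<beta> where "is_dyck \<alpha>" "is_dyck \<beta>" "P = [U] @ \<alpha> @ [D] @ \<beta>"
proof -
  from \<open>P \<noteq> []\<close> obtain s w where w: "P = s # w" by (cases P) auto
  have "s = U"
    using is_dyck_prefix[of "[s]" w] is_dyck_no_F[OF P] P w by (cases s) auto
  have "level w = -1" using is_dyck_level[OF P] w \<open>s = U\<close> by simp
  then have "\<not> (\<forall>A B. w = A @ B \<longrightarrow> 0 \<le> level A)" by (metis append_Nil2 neg_0_le_iff_le not_one_le_zero)
  with dyck_or_first_descent[of w] is_dyck_no_F[OF P] w
  obtain a b where ab: "w = a @ [D] @ b" "is_dyck a" by auto
  have "is_dyck b"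
    by (rule is_dyck_suffix[of "[U] @ a @ [D]"]) (use P w ab \<open>s = U\<close> in \<open>auto simp: is_dyck_level\<close>)
  with that ab w \<open>s = U\<close> show thesis by auto
qed

lemma last_return_ex:
  assumes "is_dyck P" and "P \<noteq> []"
  obtains \<alpha> \<delta> where "is_dyck \<alpha>" "is_dyck \<delta>" "P = \<alpha> @ [U] @ \<delta> @ [D]"
  using assms
proof (induction P arbitrary: thesis rule: length_induct)
  case (1 P)
  obtain a b where ab: "is_dyck a" "is_dyck b" "P = [U] @ a @ [D] @ b"
    using first_return_ex 1(3,4) by blast
  show ?case
  proof (cases "b = []")
    case True
    with ab show ?thesis by (intro "1.prems"(1)[of "[]" a]) auto
  next
    case False
    obtain \<alpha> \<delta> where *: "is_dyck \<alpha>" "is_dyck \<delta>" "b = \<alpha> @ [U] @ \<delta> @ [D]"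
      using "1.IH"[rule_format, of b] ab False by auto
    have "is_dyck (([U] @ a @ [D]) @ \<alpha>)"
      using is_dyck_append is_dyck_lift ab * by blast
    with * ab show ?thesis
      by (intro "1.prems"(1)[of "([U] @ a @ [D]) @ \<alpha>" \<delta>]) auto
  qed
qed

lemma first_return_unique:
  assumes eq: "a @ [D] @ b = a' @ [D] @ b'" and a: "is_dyck a" and a': "is_dyck a'"
  shows "a = a' \<and> b = b'"
proof -
  have *: False if "x = y @ [D] @ c" "is_dyck x" "is_dyck y" for x y c
    using that is_dyck_prefix[of "y @ [D]" c] by (simp add: is_dyck_level)
  from eq consider "a = a'" "b = b'" | c where "a = a' @ [D] @ c" | c where "a' = a @ [D] @ c"
    by (auto simp: append_eq_append_conv2 append_eq_Cons_conv Cons_eq_append_conv)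
  then show ?thesis by cases (use * a a' in blast)+
qed

lemma last_return_unique:
  assumes eq: "a @ [U] @ b = a' @ [U] @ b'" and b: "is_dyck b" and b': "is_dyck b'"
  shows "a = a' \<and> b = b'"
proof -
  have *: False if "x = c @ [U] @ y" "is_dyck x" "is_dyck y" for x y c
    using that is_dyck_prefix[of c "[U] @ y"] is_dyck_level[of x] is_dyck_level[of y] by simp
  from eq consider "a = a'" "b = b'" | c where "b = c @ [U] @ b'" | c where "b' = c @ [U] @ b"
    by (auto simp: append_eq_append_conv2 append_eq_Cons_conv Cons_eq_append_conv)
  then show ?thesis by cases (use * b b' in blast)+
qed

lemma first_return_is_dyck:
  "\<lbrakk>is_dyck \<alpha>; is_dyck \<beta>\<rbrakk> \<Longrightarrow> is_dyck ([U] @ \<alpha> @ [D] @ \<beta>)"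
  using is_dyck_append[OF is_dyck_lift] by simp

lemma Dh_is_dyck: "P \<in> Dh \<Longrightarrow> is_dyck P"
proof (induction rule: Dh.induct)
  case (first_return \<alpha> \<beta>)
  then show ?case by (blast intro: first_return_is_dyck)
qed simp

lemma Dh_iff:
  assumes "is_dyck \<alpha>" "is_dyck \<beta>"
  shows "[U] @ \<alpha> @ [D] @ \<beta> \<in> Dh \<longleftrightarrow> \<alpha> \<in> Dh \<and> \<beta> \<in> Dh \<and> height ([U] @ \<alpha> @ [D]) \<ge> height \<beta>"
proof
  assume "[U] @ \<alpha> @ [D] @ \<beta> \<in> Dh"
  then show "\<alpha> \<in> Dh \<and> \<beta> \<in> Dh \<and> height ([U] @ \<alpha> @ [D]) \<ge> height \<beta>"
  proof (cases rule: Dh.cases)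
    case (first_return \<alpha>' \<beta>')
    then have "\<alpha> @ [D] @ \<beta> = \<alpha>' @ [D] @ \<beta>'" by simp
    then have "\<alpha> = \<alpha>' \<and> \<beta> = \<beta>'"
      using first_return_unique assms Dh_is_dyck first_return by blast
    with first_return show ?thesis by simp
  qed simp
qed (blast intro: Dh.first_return)

lemma last_first_unique:
  assumes eq: "\<alpha> @ [U, U] @ \<beta> @ [D] @ \<gamma> @ [D] = \<alpha>' @ [U, U] @ \<beta>' @ [D] @ \<gamma>' @ [D]"
    and d: "is_dyck \<beta>" "is_dyck \<gamma>" "is_dyck \<beta>'" "is_dyck \<gamma>'"
  shows "\<alpha> = \<alpha>' \<and> \<beta> = \<beta>' \<and> \<gamma> = \<gamma>'"
proof -
  have "(\<alpha> @ [U] @ ([U] @ \<beta> @ [D] @ \<gamma>)) @ [D] = (\<alpha>' @ [U] @ ([U] @ \<beta>' @ [D] @ \<gamma>')) @ [D]"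
    using eq by simp
  then have "\<alpha> @ [U] @ ([U] @ \<beta> @ [D] @ \<gamma>) = \<alpha>' @ [U] @ ([U] @ \<beta>' @ [D] @ \<gamma>')"
    by (simp only: append_same_eq)
  then have "\<alpha> = \<alpha>' \<and> [U] @ \<beta> @ [D] @ \<gamma> = [U] @ \<beta>' @ [D] @ \<gamma>'"
    using last_return_unique first_return_is_dyck d by blast
  then show ?thesis using first_return_unique[of \<beta> \<gamma> \<beta>' \<gamma>'] d by simp
qed

lemma last_return_not_UD:
  assumes "\<alpha>' @ [U, D] = \<alpha> @ [U, U] @ \<beta> @ [D] @ \<gamma> @ [D]" "is_dyck \<beta>" "is_dyck \<gamma>"
  shows False
proof -
  have "(\<alpha>' @ [U] @ []) @ [D] = (\<alpha> @ [U] @ ([U] @ \<beta> @ [D] @ \<gamma>)) @ [D]"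
    using assms(1) by simp
  then have "\<alpha>' @ [U] @ [] = \<alpha> @ [U] @ ([U] @ \<beta> @ [D] @ \<gamma>)"
    by (simp only: append_same_eq)
  then show False
    using last_return_unique[of \<alpha>' "[]" \<alpha> "[U] @ \<beta> @ [D] @ \<gamma>"]
      first_return_is_dyck[OF assms(2,3)] by simp
qed

lemma last_first_is_dyck:
  assumes "is_dyck \<alpha>" "is_dyck \<beta>" "is_dyck \<gamma>"
  shows "is_dyck (\<alpha> @ [U, U] @ \<beta> @ [D] @ \<gamma> @ [D])"
  using is_dyck_append[OF assms(1) is_dyck_lift[OF first_return_is_dyck[OF assms(2,3)]]] by simp

lemma snoc_UD_is_dyck: "is_dyck \<alpha> \<Longrightarrow> is_dyck (\<alpha> @ [U, D])"
  using is_dyck_append[OF _ is_dyck_lift[OF is_dyck_Nil]] by simp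

text \<open>The recursion is meaningful on all Dyck paths, so \<open>phi\<close> is defined there; the map of
  interest is its restriction to \<open>Dh\<close>, and \<open>Dh_phi_arguments\<close> below shows that the recursive calls
  stay inside \<open>Dh\<close>. Values on words that are not Dyck paths are irrelevant.\<close>

function phi :: "step list \<Rightarrow> step list" where
  "phi [] = []"
| "is_dyck \<alpha> \<Longrightarrow> phi (\<alpha> @ [U, D]) = phi \<alpha> @ [F]"
| "\<lbrakk>is_dyck \<alpha>; is_dyck \<beta>; is_dyck \<gamma>\<rbrakk> \<Longrightarrow>
    phi (\<alpha> @ [U, U] @ \<beta> @ [D] @ \<gamma> @ [D]) = phi \<alpha> @ phi \<gamma> @ [U] @ phi \<beta> @ [D]"
| "\<not> is_dyck P \<Longrightarrow> phi P = []"
proof goal_cases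
  case (1 Q x)
  show ?case
  proof (cases "is_dyck x \<and> x \<noteq> []")
    case True
    then obtain \<alpha> \<delta> where *: "is_dyck \<alpha>" "is_dyck \<delta>" "x = \<alpha> @ [U] @ \<delta> @ [D]"
      using last_return_ex by blast
    show ?thesis
    proof (cases "\<delta> = []")
      case True
      with * 1(2) show ?thesis by simp
    next
      case False
      with * obtain \<beta> \<gamma> where "is_dyck \<beta>" "is_dyck \<gamma>" "\<delta> = [U] @ \<beta> @ [D] @ \<gamma>"
        using first_return_ex by blast
      with * 1(3) show ?thesis by simp
    qed
  qed (use 1 in auto)
next
  case (7 \<alpha> \<alpha>' \<beta> \<gamma>)
  then show ?case using last_return_not_UD by blast
next
  case (9 \<alpha> \<beta> \<gamma> \<alpha>' \<beta>' \<gamma>')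
  then show ?case using last_first_unique by blast
qed (use snoc_UD_is_dyck last_first_is_dyck in auto)
termination by (relation "measure length") auto

lemma height_prefix_le: "height a \<le> height (a @ b)"
  unfolding height_def
proof (rule Max_mono)
  show "(\<lambda>k. level (take k a)) ` {..length a} \<subseteq> (\<lambda>k. level (take k (a @ b))) ` {..length (a @ b)}"
  proof (rule image_subsetI)
    fix k assume "k \<in> {..length a}"
    then show "level (take k a) \<in> (\<lambda>k. level (take k (a @ b))) ` {..length (a @ b)}"
      by (intro image_eqI[of _ _ k]) auto
  qed
qed auto

lemma Dh_append_parts:
  "\<lbrakk>is_dyck \<alpha>; is_dyck \<beta>; \<alpha> @ \<beta> \<in> Dh\<rbrakk> \<Longrightarrow> \<alpha> \<in> Dh \<and> \<beta> \<in> Dh"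
proof (induction \<alpha> rule: length_induct)
  case (1 \<alpha>)
  show ?case
  proof (cases "\<alpha> = []")
    case True
    with 1 show ?thesis by (auto intro: Dh.Nil)
  next
    case False
    then obtain a b where ab: "is_dyck a" "is_dyck b" "\<alpha> = [U] @ a @ [D] @ b"
      using first_return_ex 1(2) by blast
    have "[U] @ a @ [D] @ (b @ \<beta>) \<in> Dh" using 1(4) ab by simp
    then have *: "a \<in> Dh" "b @ \<beta> \<in> Dh" "height ([U] @ a @ [D]) \<ge> height (b @ \<beta>)"
      using Dh_iff ab is_dyck_append 1(3) by blast+
    then have "b \<in> Dh" "\<beta> \<in> Dh" using 1(1)[rule_format, of b] ab 1(3) by auto
    moreover have "height ([U] @ a @ [D]) \<ge> height b"
      using *(3) height_prefix_le[of b \<beta>] by linarith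
    ultimately show ?thesis using *(1) ab(3) by (auto dest: Dh.first_return)
  qed
qed

lemma Dh_last_return:
  assumes d: "is_dyck \<alpha>" "is_dyck \<delta>" and P: "\<alpha> @ [U] @ \<delta> @ [D] \<in> Dh"
  shows "\<alpha> \<in> Dh \<and> \<delta> \<in> Dh"
proof -
  have *: "\<alpha> \<in> Dh" "[U] @ \<delta> @ [D] @ [] \<in> Dh"
    using Dh_append_parts[of \<alpha> "[U] @ \<delta> @ [D]"] is_dyck_lift d P by auto
  then have "\<delta> \<in> Dh" using Dh_iff[of \<delta> "[]"] d by simp
  with * show ?thesis by simp
qed

lemma Dh_phi_arguments:
  "\<lbrakk>is_dyck \<alpha>; \<alpha> @ [U, D] \<in> Dh\<rbrakk> \<Longrightarrow> \<alpha> \<in> Dh"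
  "\<lbrakk>is_dyck \<alpha>; is_dyck \<beta>; is_dyck \<gamma>; \<alpha> @ [U, U] @ \<beta> @ [D] @ \<gamma> @ [D] \<in> Dh\<rbrakk>
    \<Longrightarrow> \<alpha> \<in> Dh \<and> \<beta> \<in> Dh \<and> \<gamma> \<in> Dh"
proof -
  show "\<alpha> \<in> Dh" if "is_dyck \<alpha>" "\<alpha> @ [U, D] \<in> Dh"
    using Dh_last_return[of \<alpha> "[]"] that by simp
  assume d: "is_dyck \<alpha>" "is_dyck \<beta>" "is_dyck \<gamma>" and P: "\<alpha> @ [U, U] @ \<beta> @ [D] @ \<gamma> @ [D] \<in> Dh"
  have "\<alpha> \<in> Dh \<and> [U] @ \<beta> @ [D] @ \<gamma> \<in> Dh"
    by (rule Dh_last_return) (use d P first_return_is_dyck in auto)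
  then show "\<alpha> \<in> Dh \<and> \<beta> \<in> Dh \<and> \<gamma> \<in> Dh" using Dh_iff d by blast
qed

lemma phi_is_motzkin: "is_dyck P \<Longrightarrow> is_motzkin (phi P) \<and> 2 * length (phi P) = length P"
proof (induction P rule: phi.induct)
  case 1
  then show ?case by (simp add: is_motzkin_def)
next
  case (2 \<alpha>)
  have "is_motzkin [F]" by (auto simp: is_motzkin_iff Cons_eq_append_conv)
  with 2 show ?case by (auto intro: is_motzkin_append)
next
  case (3 \<alpha> \<beta> \<gamma>)
  then have "is_motzkin (phi \<alpha> @ phi \<gamma> @ ([U] @ phi \<beta> @ [D]))"
    by (intro is_motzkin_append is_motzkin_lift) auto
  with 3 show ?case by (simp only: phi.simps(3)[OF 3(1-3)]) simp
qed simp

lemma phi_in_motzkin_paths: "P \<in> Dh_paths n \<Longrightarrow> phi P \<in> motzkin_paths n"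
  using phi_is_motzkin[of P]
  by (auto simp: Dh_paths_def dyck_paths_def motzkin_paths_def is_dyck_def)

end

theory Submission
  imports Defs
begin

text \<open>Both sides satisfy the recursion that defines \<open>phi\<close>. Appending \<open>UD\<close> to a nonempty path creates
  one \<open>DUD\<close> and one \<open>F\<close>. For \<open>\<alpha>UU\<beta>D\<gamma>D\<close> the only new \<open>DUD\<close> arises when \<open>\<gamma>\<close> starts with \<open>UD\<close>. On the
  other side a new \<open>UF\<^sup>+D\<close> arises when \<open>phi \<beta>\<close> is a nonempty flat path, which cancels the correction
  term of \<open>\<beta>\<close>, so the correction terms of \<open>\<alpha>\<close> and \<open>\<gamma>\<close> remain. The height condition settles both: a
  path of \<open>Dh\<close> that starts with \<open>UD\<close> has height one, so its image is flat; hence \<open>\<alpha>\<close>, which is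
  followed by a component of height at least two, contributes nothing, and \<open>\<gamma>\<close> contributes one
  exactly when it starts with \<open>UD\<close>.\<close>

section \<open>Counting occurrences of words\<close>

lemma occ_Nil: "X \<noteq> [] \<Longrightarrow> occ X [] = 0"
  by (simp add: occ_def)

text \<open>An occurrence starts at position 0 or is a shifted occurrence in the tail. With the
  empty case, counting becomes a recursion on lists.\<close>

lemma occ_Cons:
  "X \<noteq> [] \<Longrightarrow> occ X (s # P) = of_bool (take (length X) (s # P) = X) + occ X P"
proof -
  assume X: "X \<noteq> []"
  let ?S = "\<lambda>P. {i. i + length X \<le> length P \<and> take (length X) (drop i P) = X}"
  have fin: "finite (?S P)" for P
    by (rule finite_subset[of _ "{..length P}"]) auto
  let ?Z = "if take (length X) (s # P) = X then {0::nat} else {}"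
  have "?S (s # P) = ?Z \<union> Suc ` ?S P"
  proof (rule set_eqI)
    fix i
    show "i \<in> ?S (s # P) \<longleftrightarrow> i \<in> ?Z \<union> Suc ` ?S P"
    proof (cases i)
      case 0
      have "length X \<le> length (s # P)" if "take (length X) (s # P) = X"
        using arg_cong[OF that, of length] by simp
      with 0 show ?thesis by auto
    qed auto
  qed
  moreover have "card (?Z \<union> Suc ` ?S P) = card ?Z + card (?S P)"
    using fin[of P] by (subst card_Un_disjoint) (auto simp: card_image)
  ultimately show ?thesis by (simp add: occ_def)
qed

lemma occ_singleton_append: "occ [x] (A @ B) = occ [x] A + occ [x] B"
  by (induction A) (auto simp: occ_Nil occ_Cons)

text \<open>The middle letter of \<open>DUD\<close> is \<open>U\<close>, so an occurrence through
  the marked \<open>D\<close> begins or ends there and lies in one of the two pieces that share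
  it.\<close>

lemma occ_DUD_split: "occ [D, U, D] (A @ D # B) = occ [D, U, D] (A @ [D]) + occ [D, U, D] (D # B)"
proof (induction A)
  case (Cons s A)
  have "take 3 (s # A @ D # B) = [D, U, D] \<longleftrightarrow> take 3 (s # A @ [D]) = [D, U, D]"
    by (cases A; cases "tl A") (auto simp: numeral_3_eq_3)
  with Cons show ?case by (simp add: occ_Cons numeral_3_eq_3)
qed (simp add: occ_Nil occ_Cons)

section \<open>Occurrences of \<open>UF^+D\<close>\<close>

fun flat_then_D :: "step list \<Rightarrow> bool" where
  "flat_then_D [] = False"
| "flat_then_D (s # w) = (s = D \<or> s = F \<and> flat_then_D w)"

text \<open>The recursive test stands for a prefix \<open>F^k D\<close> with some k \<ge> 0; it
  replaces the sum over k in \<open>occ_plus\<close>.\<close>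

lemma flat_then_D_iff: "flat_then_D w \<longleftrightarrow> (\<exists>k. take (Suc k) w = replicate k F @ [D])"
proof (induction w)
  case (Cons s w)
  show ?case
  proof
    assume "flat_then_D (s # w)"
    then consider "s = D" | k where "s = F" "take (Suc k) w = replicate k F @ [D]"
      using Cons by auto
    then show "\<exists>k. take (Suc k) (s # w) = replicate k F @ [D]"
    proof cases
      case 1 then show ?thesis by (intro exI[of _ 0]) simp
    next
      case (2 k) then show ?thesis by (intro exI[of _ "Suc k"]) simp
    qed
  next
    assume "\<exists>k. take (Suc k) (s # w) = replicate k F @ [D]"
    then obtain k where k: "take (Suc k) (s # w) = replicate k F @ [D]" ..
    with Cons show "flat_then_D (s # w)" by (cases k) auto
  qed
qed simp

lemma replicate_F_D_unique:
  assumes "take (Suc k) w = replicate k F @ [D]" "take (Suc l) w = replicate l F @ [D]"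
  shows "k = l"
  using assms
proof (induction w arbitrary: k l)
  case (Cons s w)
  then show ?case by (cases k; cases l) auto
qed simp

lemma occ_plus_UFD_Nil: "occ_plus [U] F [D] [] = 0"
  by (simp add: occ_plus_def)

text \<open>The first \<open>D\<close> after the leading \<open>U\<close> determines k, so at most
  one summand counts a word at the head. The condition on \<open>hd P\<close> excludes k = 0, the
  word \<open>UD\<close>.\<close>

lemma occ_plus_UFD_Cons:
  "occ_plus [U] F [D] (s # P) =
    of_bool (s = U \<and> P \<noteq> [] \<and> hd P = F \<and> flat_then_D P) + occ_plus [U] F [D] P"
proof -
  define Q where "Q k \<longleftrightarrow> s = U \<and> take (Suc k) P = replicate k F @ [D]" for k
  let ?X = "\<lambda>k. [U] @ replicate k F @ [D]"
  have occ: "occ (?X k) (s # P) = of_bool (Q k) + occ (?X k) P" for k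
    by (simp add: occ_Cons Q_def)
  have "occ_plus [U] F [D] (s # P) =
      (\<Sum>k = 1..Suc (length P). of_bool (Q k)) + (\<Sum>k = 1..Suc (length P). occ (?X k) P)"
    unfolding occ_plus_def occ by (simp add: sum.distrib)
  \<comment> \<open>The extra summand vanishes: its word is longer than \<open>P\<close>.\<close>
  also have "(\<Sum>k = 1..Suc (length P). occ (?X k) P) = occ_plus [U] F [D] P"
    by (simp add: occ_plus_def occ_eq_0)
  also have "(\<Sum>k = 1..Suc (length P). of_bool (Q k)) =
      (of_bool (s = U \<and> P \<noteq> [] \<and> hd P = F \<and> flat_then_D P) :: nat)"
  proof (cases "\<exists>k\<ge>1. Q k")
    case True
    then obtain k where k: "k \<ge> 1" "Q k" by blast
    then have "length (take (Suc k) P) = Suc k" by (simp add: Q_def)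
    then have le: "k \<le> Suc (length P)" by simp
    have uniq: "Q l \<longleftrightarrow> l = k" for l
      using k replicate_F_D_unique by (auto simp: Q_def)
    have "(\<Sum>l = 1..Suc (length P). of_bool (Q l)) = (1::nat)"
      using k le by (simp add: uniq of_bool_def del: sum.cl_ivl_Suc)
    moreover have "s = U \<and> P \<noteq> [] \<and> hd P = F \<and> flat_then_D P"
      using k by (cases P; cases k) (auto simp: Q_def flat_then_D_iff intro: exI[of _ k])
    ultimately show ?thesis by simp
  next
    case False
    have "\<not> (s = U \<and> P \<noteq> [] \<and> hd P = F \<and> flat_then_D P)"
    proof
      assume *: "s = U \<and> P \<noteq> [] \<and> hd P = F \<and> flat_then_D P"
      then obtain k where k: "take (Suc k) P = replicate k F @ [D]" by (auto simp: flat_then_D_iff)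
      with * have "k \<noteq> 0" by (cases P; cases k) auto
      with False k * show False by (auto simp: Q_def)
    qed
    moreover have "(\<Sum>k = 1..Suc (length P). of_bool (Q k)) = (0::nat)"
      using False by (intro sum.neutral) auto
    ultimately show ?thesis by simp
  qed
  finally show ?thesis .
qed

lemma flat_then_D_append: "flat_then_D (A @ D # B) \<longleftrightarrow> flat_then_D (A @ [D])"
  by (induction A) auto

text \<open>In \<open>U F^k D\<close> the letter \<open>D\<close> comes last, so no occurrence runs
  past the marked \<open>D\<close>.\<close>

lemma occ_plus_UFD_split:
  "occ_plus [U] F [D] (A @ D # B) = occ_plus [U] F [D] (A @ [D]) + occ_plus [U] F [D] (D # B)"
proof (induction A)
  case (Cons s A)
  have "hd (A @ D # B) = hd (A @ [D])" by (cases A) auto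
  with Cons show ?case by (simp add: occ_plus_UFD_Cons flat_then_D_append[of A B])
qed (simp add: occ_plus_UFD_Nil occ_plus_UFD_Cons)

text \<open>The first step of such a path other than \<open>F\<close> must be \<open>U\<close>,
  where the test fails; hence only a flat path lets it reach the final \<open>D\<close>.\<close>

lemma flat_then_D_snoc:
  assumes "\<forall>A B. M = A @ B \<longrightarrow> 0 \<le> level A"
  shows "flat_then_D (M @ [D]) \<longleftrightarrow> set M \<subseteq> {F}"
  using assms
proof (induction M)
  case (Cons s M)
  have s: "s \<noteq> D" using Cons.prems[rule_format, of "[s]" M] by auto
  show ?case
  proof (cases "s = F")
    case True
    have "\<forall>A B. M = A @ B \<longrightarrow> 0 \<le> level A"
    proof (intro allI impI)
      fix A B assume "M = A @ B"
      with Cons.prems[rule_format, of "s # A" B] True show "0 \<le> level A" by simp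
    qed
    with Cons.IH True show ?thesis by simp
  qed (use s in simp)
qed simp

text \<open>A crossing occurrence would need an image ending in \<open>U F^k\<close>. Images end in
  \<open>F\<close> or \<open>D\<close> unless empty: a final \<open>F\<close> is moved into the
  arbitrary \<open>B\<close>, and at a final \<open>D\<close> the count splits.\<close>

lemma occ_plus_UFD_phi_append:
  "occ_plus [U] F [D] (phi P @ B) = occ_plus [U] F [D] (phi P) + occ_plus [U] F [D] B"
proof (induction P arbitrary: B rule: phi.induct)
  case (2 \<alpha>)
  then show ?case by (simp add: 2(2)[of "F # B"] occ_plus_UFD_Cons occ_plus_UFD_Nil)
next
  case (3 \<alpha> \<beta> \<gamma>)
  have "occ_plus [U] F [D] (U # phi \<beta> @ D # B) =
      occ_plus [U] F [D] (U # phi \<beta> @ [D]) + occ_plus [U] F [D] B"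
    using occ_plus_UFD_split[of "U # phi \<beta>" B] by (simp add: occ_plus_UFD_Cons)
  then show ?case
    by (simp only: phi.simps(3)[OF 3(1-3)]) (simp add: 3(4-6))
qed (simp_all add: occ_plus_UFD_Nil)

section \<open>\<open>DUD\<close> at the joints of Dyck paths\<close>

lemma is_dyck_nonempty_snoc:
  assumes "is_dyck P" "P \<noteq> []"
  obtains P' where "P = P' @ [D]"
  using last_return_ex[OF assms] by (metis append_assoc)

lemma is_dyck_ConsE:
  assumes "is_dyck P" "P \<noteq> []"
  obtains t P' where "P = U # t # P'"
  using first_return_ex[OF assms] by (metis append_Cons append_Nil neq_Nil_conv)

lemma occ_DUD_snoc_UD:
  assumes "is_dyck \<alpha>"
  shows "occ [D, U, D] (\<alpha> @ [U, D]) = occ [D, U, D] \<alpha> + of_bool (\<alpha> \<noteq> [])"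
proof (cases "\<alpha> = []")
  case False
  then obtain \<alpha>' where "\<alpha> = \<alpha>' @ [D]" using is_dyck_nonempty_snoc assms by blast
  then show ?thesis
    using occ_DUD_split[of \<alpha>' "[U, D]"] by (simp add: occ_Nil occ_Cons)
qed (simp add: occ_Nil occ_Cons)

lemma occ_DUD_dyck_append_UU:
  assumes "is_dyck \<alpha>"
  shows "occ [D, U, D] (\<alpha> @ U # U # w) = occ [D, U, D] \<alpha> + occ [D, U, D] w"
proof (cases "\<alpha> = []")
  case False
  then obtain \<alpha>' where "\<alpha> = \<alpha>' @ [D]" using is_dyck_nonempty_snoc assms by blast
  then show ?thesis
    using occ_DUD_split[of \<alpha>' "U # U # w"] by (simp add: occ_Cons)
qed (simp add: occ_Nil occ_Cons)

lemma occ_DUD_dyck_append_D: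
  assumes "is_dyck \<beta>"
  shows "occ [D, U, D] (\<beta> @ D # w) = occ [D, U, D] \<beta> + occ [D, U, D] (D # w)"
proof (cases "\<beta> = []")
  case False
  then obtain \<beta>' where "\<beta> = \<beta>' @ [D]" using is_dyck_nonempty_snoc assms by blast
  then show ?thesis
    using occ_DUD_split[of \<beta>' "D # w"] by (simp add: occ_Cons)
qed (simp add: occ_Nil)

lemma occ_DUD_last_first:
  assumes "is_dyck \<alpha>" "is_dyck \<beta>" "is_dyck \<gamma>"
  shows "occ [D, U, D] (\<alpha> @ [U, U] @ \<beta> @ [D] @ \<gamma> @ [D]) =
    occ [D, U, D] \<alpha> + occ [D, U, D] \<beta> + occ [D, U, D] \<gamma> + of_bool (\<exists>r. \<gamma> = U # D # r)"
proof -
  \<comment> \<open>A nonempty \<gamma> has at least two steps, so the appended \<open>D\<close>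
    lies outside the window; an empty \<gamma> gives \<open>DD\<close>.\<close>
  have "take 3 (D # \<gamma> @ [D]) = [D, U, D] \<longleftrightarrow> (\<exists>r. \<gamma> = U # D # r)"
  proof (cases "\<gamma> = []")
    case False
    then obtain t \<gamma>' where "\<gamma> = U # t # \<gamma>'" using is_dyck_ConsE assms by blast
    then show ?thesis by (simp add: numeral_3_eq_3)
  qed (simp add: numeral_3_eq_3)
  then have "occ [D, U, D] (D # \<gamma> @ [D]) =
      of_bool (\<exists>r. \<gamma> = U # D # r) + occ [D, U, D] (\<gamma> @ [D])"
    by (simp add: occ_Cons numeral_3_eq_3)
  moreover have "occ [D, U, D] (\<gamma> @ [D]) = occ [D, U, D] \<gamma>"
    using occ_DUD_dyck_append_D[of \<gamma> "[]"] assms by (simp add: occ_Cons occ_Nil)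
  ultimately show ?thesis
    using assms by (simp add: occ_DUD_dyck_append_UU occ_DUD_dyck_append_D)
qed

section \<open>Consequences of the height condition\<close>

lemma level_le_height: "level A \<le> height (A @ B)"
  unfolding height_def by (rule Max_ge) (auto intro: image_eqI[of _ _ "length A"])

text \<open>The first component \<open>UD\<close> has height 1, which bounds the height of
  everything after it.\<close>

lemma Dh_UD_prefix_level:
  assumes "U # D # A @ B \<in> Dh"
  shows "level A \<le> 1"
proof -
  have "is_dyck ([U, D] @ (A @ B))" using assms Dh_is_dyck by simp
  then have "is_dyck (A @ B)" by (rule is_dyck_suffix) simp
  then have "height (A @ B) \<le> height [U, D]"
    using Dh_iff[of "[]" "A @ B"] assms by simp
  also have "height [U, D] = 1"
    by (simp add: height_def atMost_Suc)
  finally show ?thesis using level_le_height[of A B] by simp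
qed

text \<open>Otherwise \<open>r\<close> would return to level 0 and the following \<open>UU\<close>
  would climb to level 2.\<close>

lemma Dh_append_UU_not_UD:
  assumes "is_dyck \<alpha>" "\<alpha> @ U # U # w \<in> Dh"
  shows "\<alpha> \<noteq> U # D # r"
proof
  assume \<alpha>: "\<alpha> = U # D # r"
  then have "level (r @ [U, U]) \<le> 1"
    using Dh_UD_prefix_level[of "r @ [U, U]" w] assms by simp
  moreover have "level r = 0" using is_dyck_level[OF assms(1)] \<alpha> by simp
  ultimately show False by simp
qed

lemma phi_UD: "phi [U, D] = [F]"
  using phi.simps(2)[of "[]"] by simp

text \<open>Removing a final \<open>UD\<close> after a nonempty path keeps the first two steps. In
  the other clause the image contains \<open>U\<close>, and the height condition forbids a start
  with \<open>UD\<close>.\<close>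

lemma phi_flat_iff:
  assumes "P \<in> Dh" "P \<noteq> []"
  shows "set (phi P) \<subseteq> {F} \<longleftrightarrow> (\<exists>r. P = U # D # r)"
  using assms
proof (induction P rule: phi.induct)
  case (2 \<alpha>)
  show ?case
  proof (cases "\<alpha> = []")
    case False
    then obtain t \<alpha>' where "\<alpha> = U # t # \<alpha>'" using is_dyck_ConsE 2(1) by blast
    moreover have "phi (\<alpha> @ [U, D]) = phi \<alpha> @ [F]" using 2(1) by simp
    ultimately show ?thesis using 2 False Dh_phi_arguments(1)[of \<alpha>] by auto
  qed (use phi_UD in simp)
next
  case (3 \<alpha> \<beta> \<gamma>)
  have "\<nexists>r. \<alpha> @ [U, U] @ \<beta> @ [D] @ \<gamma> @ [D] = U # D # r"
  proof (cases "\<alpha> = []")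
    case False
    then obtain t \<alpha>' where "\<alpha> = U # t # \<alpha>'" using is_dyck_ConsE 3(1) by blast
    with Dh_append_UU_not_UD[of \<alpha> "\<beta> @ [D] @ \<gamma> @ [D]" \<alpha>'] 3 show ?thesis by auto
  qed simp
  moreover have "U \<in> set (phi (\<alpha> @ [U, U] @ \<beta> @ [D] @ \<gamma> @ [D]))"
    by (simp only: phi.simps(3)[OF 3(1-3)]) simp
  ultimately show ?case by auto
qed (use Dh_is_dyck in auto)

section \<open>The counting identity\<close>

lemma phi_eq_Nil_iff: "is_dyck P \<Longrightarrow> phi P = [] \<longleftrightarrow> P = []"
  using phi_is_motzkin[of P] by auto

text \<open>Stated additively to avoid subtraction on naturals. The correction is 0 for the empty
  path, so the identity also holds there and the induction can start.\<close>

lemma occ_DUD_Dh: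
  assumes "P \<in> Dh"
  shows "occ [D, U, D] P + occ_plus [U] F [D] (phi P) + of_bool (P \<noteq> [] \<and> set (phi P) \<subseteq> {F}) =
    occ [F] (phi P)"
  using assms
proof (induction P rule: phi.induct)
  case 1
  show ?case by (simp add: occ_Nil occ_plus_UFD_Nil)
next
  case (2 \<alpha>)
  have "\<alpha> \<in> Dh" using 2 Dh_phi_arguments(1) by blast
  \<comment> \<open>For empty \<alpha> the new \<open>F\<close> is matched by the correction turning
    from 0 to 1; otherwise by a new \<open>DUD\<close>, with the correction unchanged.\<close>
  with 2 show ?case
    by (cases "\<alpha> = []"; cases "set (phi \<alpha>) \<subseteq> {F}")
      (simp_all add: phi_UD occ_DUD_snoc_UD occ_plus_UFD_phi_append occ_singleton_append
        occ_plus_UFD_Cons occ_plus_UFD_Nil occ_Cons occ_Nil)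
next
  case (3 \<alpha> \<beta> \<gamma>)
  let ?P = "\<alpha> @ [U, U] @ \<beta> @ [D] @ \<gamma> @ [D]"
  note phi_P = phi.simps(3)[OF 3(1-3)]
  have Dh: "\<alpha> \<in> Dh" "\<beta> \<in> Dh" "\<gamma> \<in> Dh" using Dh_phi_arguments(2) 3 by blast+
  have \<alpha>: "\<not> (\<alpha> \<noteq> [] \<and> set (phi \<alpha>) \<subseteq> {F})"
    using phi_flat_iff[OF Dh(1)] Dh_append_UU_not_UD[of \<alpha>] 3 by auto
  have \<gamma>: "(\<gamma> \<noteq> [] \<and> set (phi \<gamma>) \<subseteq> {F}) \<longleftrightarrow> (\<exists>r. \<gamma> = U # D # r)"
    using phi_flat_iff[OF Dh(3)] by auto
  have "flat_then_D (phi \<beta> @ [D]) \<longleftrightarrow> set (phi \<beta>) \<subseteq> {F}"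
    using phi_is_motzkin[OF 3(2)] by (intro flat_then_D_snoc) (simp add: is_motzkin_iff)
  \<comment> \<open>The condition on the head fails for empty \<beta>, where \<open>UD\<close>
    arises without a flat step.\<close>
  then have "(hd (phi \<beta> @ [D]) = F \<and> flat_then_D (phi \<beta> @ [D])) \<longleftrightarrow> \<beta> \<noteq> [] \<and> set (phi \<beta>) \<subseteq> {F}"
    using phi_eq_Nil_iff[OF 3(2)] by (cases "phi \<beta>") auto
  then have "occ_plus [U] F [D] (U # phi \<beta> @ [D]) =
      of_bool (\<beta> \<noteq> [] \<and> set (phi \<beta>) \<subseteq> {F}) + occ_plus [U] F [D] (phi \<beta>)"
    by (simp add: occ_plus_UFD_Cons[of U] occ_plus_UFD_phi_append)
      (simp add: occ_plus_UFD_Cons occ_plus_UFD_Nil)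
  then have plus: "occ_plus [U] F [D] (phi ?P) = occ_plus [U] F [D] (phi \<alpha>) +
      occ_plus [U] F [D] (phi \<gamma>) + occ_plus [U] F [D] (phi \<beta>) +
      of_bool (\<beta> \<noteq> [] \<and> set (phi \<beta>) \<subseteq> {F})"
    by (simp only: phi_P) (simp add: occ_plus_UFD_phi_append)
  have F: "occ [F] (phi ?P) = occ [F] (phi \<alpha>) + occ [F] (phi \<gamma>) + occ [F] (phi \<beta>)"
    by (simp only: phi_P occ_singleton_append) (simp add: occ_Cons occ_Nil)
  have flat: "\<not> set (phi ?P) \<subseteq> {F}"
    by (simp only: phi_P) simp
  show ?case
    using 3(4)[OF Dh(1)] 3(5,6) Dh \<alpha> \<gamma> plus F flat occ_DUD_last_first[OF 3(1-3)]
    by simp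
qed (use Dh_is_dyck in auto)

theorem theorem6:
  fixes n :: nat and P :: "step list"
  assumes "n \<ge> 1" and "P \<in> Dh_paths n"
  shows "int (occ [D, U, D] P) =
    int (occ [F] (phi P)) - int (occ_plus [U] F [D] (phi P)) - int (delta_F n (phi P))"
proof -
  have P: "P \<in> Dh" using assms(2) by (simp add: Dh_paths_def)
  have len: "length (phi P) = n"
    using phi_in_motzkin_paths[OF assms(2)] by (simp add: motzkin_paths_def)
  \<comment> \<open>This is where n \<ge> 1 enters: for the empty path \<open>delta_F\<close> is 1
    but the correction is 0.\<close>
  then have "P \<noteq> []" using assms(1) by auto
  moreover have "phi P = replicate n F \<longleftrightarrow> set (phi P) \<subseteq> {F}"
    using len by (metis replicate_eqI set_replicate_conv_if subset_singletonD empty_iff empty_subsetI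
        insert_iff subset_refl)
  ultimately have "delta_F n (phi P) = of_bool (P \<noteq> [] \<and> set (phi P) \<subseteq> {F})"
    by (simp add: delta_F_def)
  with occ_DUD_Dh[OF P] show ?thesis by linarith
qed

end
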